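(* Let $A=\bigoplus_{t\in T} A^{(t)}$ be a finite dimensional $T$-graded algebra over a field $F$ of characteristic $0$ for some semigroup $T$ such that $A/J(A) \cong M_k(F)$ for some $k\in\mathbb N$ and $A^{(t)}\cap J(A) = 0$ for all $t\in T$. Let $r:=\dim A$ and let $\gamma_\ell$, $1\leqslant \ell \leqslant r$, be the integers defined in the context (from a choice of bases of the $A^{(t)}$ and of an isomorphism $\psi\colon A/J(A)\to M_k(F)$). Suppose $\sum_{i=1}^r \gamma_i \geqslant 0$. Let $\zeta$ be the positive root of the equation $\sum_{i=1}^r \gamma_i \zeta^{\gamma_i-\gamma_1} = 0$. Then $$\mathop{\overline\lim}\limits_{n\rightarrow\infty} \sqrt[n]{c_n^{T\text{-}\mathrm{gr}}(A)}\leqslant \sum_{i=1}^r \zeta^{\gamma_i}.$$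
   Context: Algebras are associative, not necessarily unital; $J(A)$ is the Jacobson radical; $T$-graded means $A=\bigoplus_{t\in T}A^{(t)}$ (subspaces) with $A^{(s)}A^{(t)}\subseteq A^{(st)}$. Numbers $\gamma_\ell$: For every $t\in T$ fix a basis $\mathcal B^{(t)}$ of $A^{(t)}$, let $\mathcal B=\bigcup_{t\in T}\mathcal B^{(t)}$ (a basis of $A$), fix an isomorphism $\psi\colon A/J(A)\to M_k(F)$, and let $\pi\colon A\to A/J(A)$ be the natural epimorphism. For $a\in\mathcal B$ with $\psi\pi(a)=\sum_{i,j}\alpha_{ij}e_{ij}$ ($e_{ij}$ the matrix units) put $\theta(a)=\min\{i-j\mid \alpha_{ij}\ne0,\ 1\leqslant i,j\leqslant k\}$. Put $\beta_0=0$, $\beta_\ell=\min\{\sum_{i=1}^\ell\theta(a_i)\mid a_i\in\mathcal B,\ a_i\ne a_j\text{ for }i\ne j\}$ and $\gamma_\ell=\beta_\ell-\beta_{\ell-1}$ for $1\leqslant\ell\leqslant r$. (Equivalently, $\gamma_1\leqslant\ldots\leqslant\gamma_r$ are the values $\theta(a)$, $a\in\mathcal B$, in non-decreasing order.) Graded codimensions: let $F\langle X^{T\text{-}\mathrm{gr}}\rangle$ be the free associative algebra without $1$ on variables $x_i^{(t)}$, $i\in\mathbb N$, $t\in T$. A polynomial $f(x_{i_1}^{(t_1)},\ldots,x_{i_s}^{(t_s)})$ is a graded polynomial identity of $A$ if it vanishes under all substitutions of elements of $A^{(t_j)}$ for $x_{i_j}^{(t_j)}$; $\operatorname{Id}^{T\text{-}\mathrm{gr}}(A)$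 is the set of these. With $P_n^{T\text{-}\mathrm{gr}}=\langle x_{\sigma(1)}^{(t_1)}\cdots x_{\sigma(n)}^{(t_n)}\mid t_i\in T,\ \sigma\in S_n\rangle_F$, one sets $c_n^{T\text{-}\mathrm{gr}}(A)=\dim\bigl(P_n^{T\text{-}\mathrm{gr}}/(P_n^{T\text{-}\mathrm{gr}}\cap\operatorname{Id}^{T\text{-}\mathrm{gr}}(A))\bigr)$. *)

theory Defs
  imports
    Complex_Main
    "HOL-Library.Extended_Real"
    "HOL-Library.Liminf_Limsup"
    "HOL-Library.Poly_Mapping"
    "HOL-Library.Set_Algebras"
    "HOL-Combinatorics.Permutations"
    "Jordan_Normal_Form.Matrix"
begin

section \<open>Algebras, radical, grading\<close>

locale assoc_algebra = vector_space sc
  for sc :: "'f::field \<Rightarrow> 'a::ring \<Rightarrow> 'a" +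
  assumes scale_mult_left: "sc c x * y = sc c (x * y)"
    and scale_mult_right: "x * sc c y = sc c (x * y)"

definition finite_dim :: "('f::field \<Rightarrow> 'v::ab_group_add \<Rightarrow> 'v) \<Rightarrow> bool" where
  "finite_dim sc \<longleftrightarrow> (\<exists>B. finite B \<and> Modules.module.span sc B = UNIV)"

definition is_basis_of ::
  "('f::field \<Rightarrow> 'v::ab_group_add \<Rightarrow> 'v) \<Rightarrow> 'v set \<Rightarrow> 'v set \<Rightarrow> bool" where
  "is_basis_of sc V B \<longleftrightarrow>
     \<not> Modules.module.dependent sc B \<and> Modules.module.span sc B = V"

definition left_ideal :: "'a::ring set \<Rightarrow> bool" where
  "left_ideal L \<longleftrightarrow> 0 \<in> L \<and> (\<forall>x\<in>L. \<forall>y\<in>L. x - y \<in> L) \<and> (\<forall>a. \<forall>x\<in>L. a * x \<in> L)"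

definition modular_left_ideal :: "'a::ring set \<Rightarrow> bool" where
  "modular_left_ideal L \<longleftrightarrow> left_ideal L \<and> (\<exists>e. \<forall>a. a - a * e \<in> L)"

definition maximal_modular_left_ideal :: "'a::ring set \<Rightarrow> bool" where
  "maximal_modular_left_ideal L \<longleftrightarrow>
     modular_left_ideal L \<and> L \<noteq> UNIV \<and>
     (\<forall>L'. left_ideal L' \<and> L \<subseteq> L' \<longrightarrow> L' = L \<or> L' = UNIV)"

text \<open>The standard definition for rings that need not have a unit: without
  modularity it would be wrong, and the intersection is the whole ring
  if there is no maximal modular left ideal.\<close>

definition jacobson_radical :: "'a::ring set" where
  "jacobson_radical = \<Inter> {L. maximal_modular_left_ideal L}"

text \<open>The sum being direct is expressed by unique decomposition into finitely many
  homogeneous components; the index semigroup may be infinite.\<close>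

definition graded_by ::
  "('f::field \<Rightarrow> 'a::ring \<Rightarrow> 'a) \<Rightarrow> ('t::semigroup_mult \<Rightarrow> 'a set) \<Rightarrow> bool" where
  "graded_by sc A \<longleftrightarrow>
     (\<forall>t. Modules.module.subspace sc (A t)) \<and>
     (\<forall>a. \<exists>!f. (\<forall>t. f t \<in> A t) \<and> finite {t. f t \<noteq> 0} \<and> a = (\<Sum>t | f t \<noteq> 0. f t)) \<and>
     (\<forall>s t. \<forall>x\<in>A s. \<forall>y\<in>A t. x * y \<in> A (s * t))"

text \<open>The quotient by a two-sided ideal \<open>J\<close> is the set of cosets \<open>a +o J\<close>;
  its operations are those of representatives.\<close>

definition quotient_mat_iso ::
  "('f::field \<Rightarrow> 'a::ring \<Rightarrow> 'a) \<Rightarrow> 'a set \<Rightarrow> nat \<Rightarrow> ('a set \<Rightarrow> 'f mat) \<Rightarrow> bool" where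
  "quotient_mat_iso sc J k \<psi> \<longleftrightarrow>
     bij_betw \<psi> (range (\<lambda>a. a +o J)) (carrier_mat k k) \<and>
     (\<forall>a b. \<psi> ((a + b) +o J) = \<psi> (a +o J) + \<psi> (b +o J)) \<and>
     (\<forall>a b. \<psi> ((a * b) +o J) = \<psi> (a +o J) * \<psi> (b +o J)) \<and>
     (\<forall>c a. \<psi> (sc c a +o J) = c \<cdot>\<^sub>m \<psi> (a +o J))"

section \<open>The integers $\gamma_\ell$\<close>

text \<open>Matrix indices run from 0 to \<open>k - 1\<close> instead of 1 to \<open>k\<close>; the differences
  \<open>i - j\<close> are unaffected.\<close>

definition theta :: "nat \<Rightarrow> ('a::ring set \<Rightarrow> 'f::field mat) \<Rightarrow> 'a \<Rightarrow> int" where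
  "theta k \<psi> a =
     Min {int i - int j | i j. i < k \<and> j < k \<and> \<psi> (a +o jacobson_radical) $$ (i, j) \<noteq> 0}"

definition beta :: "nat \<Rightarrow> ('a::ring set \<Rightarrow> 'f::field mat) \<Rightarrow> 'a set \<Rightarrow> nat \<Rightarrow> int" where
  "beta k \<psi> B l =
     Min {(\<Sum>a\<leftarrow>as. theta k \<psi> a) | as. length as = l \<and> distinct as \<and> set as \<subseteq> B}"

definition gamma :: "nat \<Rightarrow> ('a::ring set \<Rightarrow> 'f::field mat) \<Rightarrow> 'a set \<Rightarrow> nat \<Rightarrow> int" where
  "gamma k \<psi> B l = beta k \<psi> B l - beta k \<psi> B (l - 1)"

section \<open>Graded polynomials and codimensions\<close>

text \<open>The variable $x_i^{(t)}$ is the pair \<open>(i, t)\<close>. A graded polynomial is a finitely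
  supported family of coefficients on words in the variables; excluding the empty word gives
  the free algebra without unit.\<close>

type_synonym ('t, 'f) gr_poly = "(nat \<times> 't) list \<Rightarrow>\<^sub>0 'f"

definition free_gr_algebra :: "('t, 'f::field) gr_poly set" where
  "free_gr_algebra = {f. [] \<notin> Poly_Mapping.keys f}"

definition poly_scale :: "'f::field \<Rightarrow> ('t, 'f) gr_poly \<Rightarrow> ('t, 'f) gr_poly" where
  "poly_scale c f = Poly_Mapping.map ((*) c) f"

lemma lookup_poly_scale:
  "Poly_Mapping.lookup (poly_scale c f) w = c * Poly_Mapping.lookup f w"
  by (simp add: poly_scale_def Poly_Mapping.map.rep_eq when_def)

lemma vector_space_poly_scale: "vector_space (poly_scale :: 'f::field \<Rightarrow> ('t, 'f) gr_poly \<Rightarrow> _)"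
  by unfold_locales
    (auto intro!: poly_mapping_eqI simp: lookup_poly_scale lookup_add algebra_simps)

text \<open>The value at the empty word is irrelevant, since it does not occur in
  elements of \<open>free_gr_algebra\<close>.\<close>

fun word_prod :: "'a::ring list \<Rightarrow> 'a" where
  "word_prod [] = 0"
| "word_prod [x] = x"
| "word_prod (x # y # ys) = x * word_prod (y # ys)"

definition eval_poly ::
  "('f::field \<Rightarrow> 'a::ring \<Rightarrow> 'a) \<Rightarrow> (nat \<times> 't \<Rightarrow> 'a) \<Rightarrow> ('t, 'f) gr_poly \<Rightarrow> 'a" where
  "eval_poly sc s f =
     (\<Sum>w\<in>Poly_Mapping.keys f. sc (Poly_Mapping.lookup f w) (word_prod (map s w)))"

definition graded_identities ::
  "('f::field \<Rightarrow> 'a::ring \<Rightarrow> 'a) \<Rightarrow> ('t \<Rightarrow> 'a set) \<Rightarrow> ('t, 'f) gr_poly set" where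
  "graded_identities sc A =
     {f \<in> free_gr_algebra. \<forall>s. (\<forall>i t. s (i, t) \<in> A t) \<longrightarrow> eval_poly sc s f = 0}"

definition multilinear_polys :: "nat \<Rightarrow> ('t, 'f::field) gr_poly set" where
  "multilinear_polys n =
     Modules.module.span poly_scale
       {Poly_Mapping.single (map (\<lambda>i. (\<sigma> i, t i)) [1..<n + 1]) 1 | \<sigma> t. \<sigma> permutes {1..n}}"

text \<open>\<open>B\<close> is a set of representatives of a basis of \<open>V / W\<close>, where \<open>W\<close> is a subspace of \<open>V\<close>:
  a linear combination of cosets is zero in the quotient iff the same combination of
  representatives lies in \<open>W\<close>. Distinct elements of such a \<open>B\<close> have distinct cosets.\<close>

definition quotient_basis ::
  "('f::field \<Rightarrow> 'v::ab_group_add \<Rightarrow> 'v) \<Rightarrow> 'v set \<Rightarrow> 'v set \<Rightarrow> 'v set \<Rightarrow> bool" where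
  "quotient_basis sc V W B \<longleftrightarrow>
     B \<subseteq> V \<and>
     (\<forall>S u. finite S \<and> S \<subseteq> B \<and> (\<Sum>b\<in>S. sc (u b) b) \<in> W \<longrightarrow> (\<forall>b\<in>S. u b = 0)) \<and>
     (\<forall>v\<in>V. \<exists>S u. finite S \<and> S \<subseteq> B \<and> v - (\<Sum>b\<in>S. sc (u b) b) \<in> W)"

text \<open>As for the library's \<open>dim\<close>, the value is 0 if the quotient is infinite-dimensional.\<close>

definition quotient_dim ::
  "('f::field \<Rightarrow> 'v::ab_group_add \<Rightarrow> 'v) \<Rightarrow> 'v set \<Rightarrow> 'v set \<Rightarrow> nat" where
  "quotient_dim sc V W = card (SOME B. quotient_basis sc V W B)"

definition graded_codim ::
  "('f::field \<Rightarrow> 'a::ring \<Rightarrow> 'a) \<Rightarrow> ('t \<Rightarrow> 'a set) \<Rightarrow> nat \<Rightarrow> nat" where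
  "graded_codim sc A n =
     quotient_dim poly_scale (multilinear_polys n)
       (multilinear_polys n \<inter> graded_identities sc A)"

end

theory Submission
  imports Defs "HOL-Library.Function_Algebras"
begin

text \<open>A multilinear graded polynomial is determined modulo identities by its values on
  homogeneous basis elements, so $c_n$ is at most $\dim A$ times the number of tuples
  $(b_1,\ldots,b_n)$ of basis elements with a nonzero product in some order. Such a product is
  homogeneous, hence nonzero in $M_k(F)$ too; as $\theta$ is superadditive, this forces
  $\theta(b_1)+\ldots+\theta(b_n)\le k-1$. For $0<z\le 1$ at most
  $z^{1-k}\bigl(\sum_b z^{\theta(b)}\bigr)^n$ tuples satisfy this inequality (Chernoff's bound),
  and $\sum\gamma_i\ge 0$ gives $\zeta\le 1$ unless all $\gamma_i$ vanish.\<close>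

section \<open>Bases and dimension of a quotient space\<close>

text \<open>Extend a basis \<open>B0\<close> of \<open>W\<close> to a basis \<open>B1\<close> of
  \<open>V\<close>; the added vectors represent a basis of the quotient. This guarantees that the
  \<open>SOME\<close> in \<open>quotient_dim\<close> selects a genuine quotient basis.\<close>

lemma (in vector_space) quotient_basis_exists:
  assumes "subspace V" "subspace W" "W \<subseteq> V"
  shows "\<exists>B. quotient_basis scale V W B"
proof -
  obtain B0 where B0: "B0 \<subseteq> W" "independent B0" "W \<subseteq> span B0"
    by (rule maximal_independent_subset)
  then have spanB0: "span B0 = W"
    using span_minimal[OF B0(1) assms(2)] by (intro antisym)
  obtain B1 where B1: "B0 \<subseteq> B1" "B1 \<subseteq> V" "independent B1" "V \<subseteq> span B1"
    using maximal_independent_subset_extend[OF subset_trans[OF B0(1) assms(3)] B0(2)] .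
  have fin_comb: "\<exists>S u. finite S \<and> S \<subseteq> B1 - B0 \<and> v - (\<Sum>b\<in>S. scale (u b) b) \<in> W"
    if v: "v \<in> V" for v
  proof -
    obtain t u where t: "finite t" "t \<subseteq> B1" "v = (\<Sum>b\<in>t. scale (u b) b)"
      using subsetD[OF B1(4) v] unfolding span_explicit by auto
    have "v = (\<Sum>b\<in>t \<inter> B0. scale (u b) b) + (\<Sum>b\<in>t - B0. scale (u b) b)"
      unfolding t(3) by (rule sum.Int_Diff[OF t(1)])
    moreover have "(\<Sum>b\<in>t \<inter> B0. scale (u b) b) \<in> W"
      unfolding spanB0[symmetric] by (intro span_sum span_scale span_base) auto
    ultimately have "v - (\<Sum>b\<in>t - B0. scale (u b) b) \<in> W"
      by simp
    then show ?thesis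
      using t(1,2) by (intro exI[of _ "t - B0"] exI[of _ u]) auto
  qed
  have indep: "u b = 0"
    if S: "finite S" "S \<subseteq> B1 - B0" "(\<Sum>b\<in>S. scale (u b) b) \<in> W" and "b \<in> S" for S u b
  proof -
    let ?v = "\<Sum>b\<in>S. scale (u b) b"
    define w where "w = representation B0 ?v"
    define t where "t = {b. w b \<noteq> 0}"
    have "?v \<in> span B0"
      using S(3) spanB0 by simp
    then have t: "finite t" "t \<subseteq> B0" "?v = (\<Sum>b\<in>t. scale (w b) b)"
      using sum_nonzero_representation_eq[OF B0(2)] finite_representation[of B0 ?v]
        representation_ne_zero[of B0 ?v] by (auto simp: t_def w_def)
    \<comment> \<open>Equating the two expansions of \<open>?v\<close> gives one linear relation
      inside the independent set \<open>B1\<close>, with coefficients \<open>u\<close> on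
      \<open>S\<close> and \<open>- w\<close> on \<open>t\<close>.\<close>
    define c where "c x = (if x \<in> S then u x else - w x)" for x
    have "S \<inter> t = {}"
      using S t by blast
    then have "(\<Sum>x\<in>S \<union> t. scale (c x) x) = (\<Sum>x\<in>S. scale (c x) x) + (\<Sum>x\<in>t. scale (c x) x)"
      using S t by (intro sum.union_disjoint) auto
    also have "(\<Sum>x\<in>S. scale (c x) x) = (\<Sum>x\<in>S. scale (u x) x)"
      by (intro sum.cong) (auto simp: c_def)
    also have "(\<Sum>x\<in>t. scale (c x) x) = - (\<Sum>x\<in>t. scale (w x) x)"
      unfolding sum_negf[symmetric] using \<open>S \<inter> t = {}\<close> by (intro sum.cong) (auto simp: c_def)
    finally have "(\<Sum>x\<in>S \<union> t. scale (c x) x) = 0"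
      using t(3) by simp
    moreover have "finite (S \<union> t)" "S \<union> t \<subseteq> B1"
      using S t B1(1) by auto
    ultimately have "c b = 0"
      using B1(3) \<open>b \<in> S\<close> unfolding independent_explicit_module by (meson UnI1)
    then show "u b = 0"
      using \<open>b \<in> S\<close> by (simp add: c_def)
  qed
  have "quotient_basis scale V W (B1 - B0)"
    unfolding quotient_basis_def
  proof (intro conjI allI ballI impI)
    show "B1 - B0 \<subseteq> V"
      using B1(2) by blast
  next
    fix S u b assume "finite S \<and> S \<subseteq> B1 - B0 \<and> (\<Sum>b\<in>S. scale (u b) b) \<in> W" "b \<in> S"
    then show "u b = 0"
      using indep[of S u b] by simp
  next
    fix v assume "v \<in> V"
    then show "\<exists>S u. finite S \<and> S \<subseteq> B1 - B0 \<and> v - (\<Sum>b\<in>S. scale (u b) b) \<in> W"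
      by (rule fin_comb)
  qed
  then show ?thesis ..
qed

text \<open>The functionals \<open>L _ i\<close> with \<open>i \<in> I\<close> have their common
  kernel on \<open>V\<close> inside \<open>W\<close>. So \<open>L\<close> maps a quotient basis
  injectively to an independent family of functions supported on the finite set
  \<open>I\<close>.\<close>

lemma (in vector_space) card_quotient_basis_le:
  fixes L :: "'b \<Rightarrow> 'i \<Rightarrow> 'a"
  assumes V: "subspace V" and B: "quotient_basis scale V W B"
    and add: "\<And>x y i. L (x + y) i = L x i + L y i"
    and scale: "\<And>c x i. L (scale c x) i = c * L x i"
    and "finite I" and supp: "\<And>x i. x \<in> V \<Longrightarrow> i \<notin> I \<Longrightarrow> L x i = 0"
    and ker: "\<And>x. x \<in> V \<Longrightarrow> (\<And>i. L x i = 0) \<Longrightarrow> x \<in> W"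
  shows "card B \<le> card I"
proof -
  interpret F: vector_space "\<lambda>c (f :: 'i \<Rightarrow> 'a) i. c * f i"
    by unfold_locales (auto simp: fun_eq_iff algebra_simps)
  have L0: "L 0 i = 0" for i
    using scale[of 0 0] by simp
  have L_sum: "L (\<Sum>b\<in>S. scale (u b) b) i = (\<Sum>b\<in>S. u b * L b i)" for S u i
    by (induction S rule: infinite_finite_induct) (simp_all add: L0 add scale)
  have "B \<subseteq> V" using B by (simp add: quotient_basis_def)
  have coeffs_zero: "u b = 0"
    if "finite S" "S \<subseteq> B" "\<And>i. (\<Sum>b\<in>S. u b * L b i) = 0" "b \<in> S" for S u b
  proof -
    have "(\<Sum>b\<in>S. scale (u b) b) \<in> V"
      using that \<open>B \<subseteq> V\<close> by (intro subspace_sum[OF V] subspace_scale[OF V]) auto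
    then have "(\<Sum>b\<in>S. scale (u b) b) \<in> W"
      by (rule ker) (simp add: L_sum that)
    then show ?thesis
      using B that unfolding quotient_basis_def by blast
  qed
  have "inj_on L B"
  proof (rule inj_onI, rule ccontr)
    fix a b assume ab: "a \<in> B" "b \<in> B" "L a = L b" "a \<noteq> b"
    \<comment> \<open>The combination \<open>a - b\<close> is killed by every functional, although
      its coefficient at \<open>a\<close> is 1.\<close>
    have "(if a = a then 1 else -1 :: 'a) = 0"
      by (rule coeffs_zero[of "{a, b}" "\<lambda>x. if x = a then 1 else -1" a]) (use ab in auto)
    then show False by simp
  qed
  have "F.independent (L ` B)"
    unfolding F.independent_explicit_module
  proof (intro allI impI)
    fix T u v assume T: "finite T" "T \<subseteq> L ` B" "(\<Sum>v\<in>T. (\<lambda>i. u v * v i)) = 0" "v \<in> T"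
    obtain S where S: "S \<subseteq> B" "finite S" "T = L ` S"
      using finite_subset_image[OF T(1,2)] by blast
    have inj: "inj_on L S"
      using \<open>inj_on L B\<close> S(1) inj_on_subset by blast
    obtain b where b: "b \<in> S" "v = L b"
      using T(4) S by blast
    have "(\<Sum>b\<in>S. u (L b) * L b i) = 0" for i
    proof -
      have "(\<Sum>b\<in>S. u (L b) * L b i) = (\<Sum>v\<in>T. u v * v i)"
        unfolding S(3) by (simp add: sum.reindex[OF inj])
      also have "\<dots> = (\<Sum>v\<in>T. (\<lambda>i. u v * v i)) i"
        by (induction T rule: infinite_finite_induct) auto
      finally show ?thesis using T(3) by simp
    qed
    then show "u v = 0"
      using coeffs_zero[of S "\<lambda>b. u (L b)" b] S b by blast
  qed
  \<comment> \<open>The indicator functions of the points of \<open>I\<close> span all functions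
    supported on \<open>I\<close>.\<close>
  moreover define E where "E = (\<lambda>i j. if j = i then 1 else 0 :: 'a) ` I"
  have "L ` B \<subseteq> F.span E"
  proof
    fix f assume "f \<in> L ` B"
    then have f: "f i = 0" if "i \<notin> I" for i
      using supp \<open>B \<subseteq> V\<close> that by auto
    have "f j = (\<Sum>i\<in>I. (\<lambda>j. f i * (if j = i then 1 else 0))) j" for j
    proof -
      have "(\<Sum>i\<in>K. (\<lambda>j. f i * (if j = i then 1 else 0))) j = (\<Sum>i\<in>K. if j = i then f i else 0)" for K
        by (induction K rule: infinite_finite_induct) auto
      then show ?thesis
        using f \<open>finite I\<close> by simp
    qed
    then have "f = (\<Sum>i\<in>I. (\<lambda>j. f i * (if j = i then 1 else 0)))"
      by blast
    moreover have "\<dots> \<in> F.span E"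
      by (intro F.span_sum F.span_scale F.span_base) (auto simp: E_def)
    ultimately show "f \<in> F.span E" by simp
  qed
  moreover have "finite E" "card E \<le> card I"
    using \<open>finite I\<close> by (auto simp: E_def intro: card_image_le)
  ultimately have "card (L ` B) \<le> card I"
    using F.independent_span_bound[of E "L ` B"] by linarith
  then show ?thesis
    by (simp add: card_image[OF \<open>inj_on L B\<close>])
qed

section \<open>Values of \<open>theta\<close> in sorted order, and numerical estimates\<close>

text \<open>The common part of \<open>P\<close> and \<open>Q\<close> cancels; the remaining parts
  are equally large and separated by the threshold \<open>m\<close>.\<close>

lemma sum_smallest_le:
  fixes f :: "'b \<Rightarrow> 'c::linordered_idom"
  assumes "finite P" "finite Q" "card P = card Q"
    and "\<And>p. p \<in> P \<Longrightarrow> f p \<le> m" "\<And>q. q \<in> Q - P \<Longrightarrow> m \<le> f q"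
  shows "sum f P \<le> sum f Q"
proof -
  have "card (P - Q) = card (Q - P)"
    using assms(1-3) by (simp add: card_Diff_subset_Int Int_commute)
  have "sum f (P - Q) \<le> of_nat (card (P - Q)) * m"
    using assms(4) by (intro sum_bounded_above) auto
  also have "\<dots> \<le> sum f (Q - P)"
    unfolding \<open>card (P - Q) = card (Q - P)\<close> using assms(5) by (intro sum_bounded_below) auto
  finally show ?thesis
    using sum.Int_Diff[OF assms(1), of f Q] sum.Int_Diff[OF assms(2), of f P]
    by (simp add: Int_commute)
qed

text \<open>Once the basis is sorted by \<open>theta\<close>, the first \<open>l\<close> elements
  attain the minimum that defines \<open>beta\<close>.\<close>

lemma beta_eq_sum_take:
  assumes "sorted (map (theta k \<psi>) bs)" "distinct bs" "l \<le> length bs"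
  shows "beta k \<psi> (set bs) l = (\<Sum>a\<leftarrow>take l bs. theta k \<psi> a)"
  unfolding beta_def
proof (rule Min_eqI)
  let ?\<theta> = "theta k \<psi>"
  have "finite ((\<lambda>as. \<Sum>a\<leftarrow>as. ?\<theta> a) ` {as. set as \<subseteq> set bs \<and> length as = l})"
    by (intro finite_imageI finite_lists_length_eq) auto
  then show "finite {(\<Sum>a\<leftarrow>as. ?\<theta> a) | as. length as = l \<and> distinct as \<and> set as \<subseteq> set bs}"
    by (rule finite_subset[rotated]) auto
  show "(\<Sum>a\<leftarrow>take l bs. ?\<theta> a) \<in> {(\<Sum>a\<leftarrow>as. ?\<theta> a) | as. length as = l \<and> distinct as \<and> set as \<subseteq> set bs}"
    using assms by (intro CollectI exI[of _ "take l bs"]) (auto dest: in_set_takeD)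
  fix y assume "y \<in> {(\<Sum>a\<leftarrow>as. ?\<theta> a) | as. length as = l \<and> distinct as \<and> set as \<subseteq> set bs}"
  then obtain as where as: "length as = l" "distinct as" "set as \<subseteq> set bs" "y = (\<Sum>a\<leftarrow>as. ?\<theta> a)"
    by blast
  have "sum ?\<theta> (set (take l bs)) \<le> sum ?\<theta> (set as)"
  \<comment> \<open>The threshold is the last entry \<open>bs ! (l - 1)\<close> of the prefix, which
    exists only for nonzero \<open>l\<close>.\<close>
  proof (cases "l = 0")
    case False
    show ?thesis
    proof (rule sum_smallest_le)
      show "card (set (take l bs)) = card (set as)"
        using as assms by (simp add: distinct_card)
      show "?\<theta> p \<le> ?\<theta> (bs ! (l - 1))" if p: "p \<in> set (take l bs)" for p
      proof -
        obtain i where "i < l" "p = bs ! i"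
          using p by (metis in_set_conv_nth length_take min_less_iff_conj nth_take)
        then show ?thesis
          using sorted_nth_mono[OF assms(1), of i "l - 1"] assms(3) False by simp
      qed
      show "?\<theta> (bs ! (l - 1)) \<le> ?\<theta> q" if q: "q \<in> set as - set (take l bs)" for q
      proof -
        obtain i where i: "i < length bs" "q = bs ! i"
          using q as(3) by (metis DiffD1 in_set_conv_nth subsetD)
        have "\<not> i < l"
          using q i by (auto simp: in_set_conv_nth)
        then show ?thesis
          using sorted_nth_mono[OF assms(1), of "l - 1" i] i by simp
      qed
    qed auto
  qed (use as in auto)
  then show "(\<Sum>a\<leftarrow>take l bs. ?\<theta> a) \<le> y"
    using as assms by (simp add: sum_list_distinct_conv_sum_set)
qed

text \<open>Consecutive prefix sums differ by one entry, so the \<open>gamma\<close> values are the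
  \<open>theta\<close> values in sorted order. The arbitrary \<open>h\<close> allows sums of powers
  to be reindexed.\<close>

lemma sum_gamma:
  assumes "finite B"
  shows "(\<Sum>i=1..card B. h (gamma k \<psi> B i)) = (\<Sum>b\<in>B. h (theta k \<psi> b))"
proof -
  obtain xs where xs: "set xs = B" "distinct xs"
    using finite_distinct_list[OF assms] by blast
  define bs where "bs = sort_key (theta k \<psi>) xs"
  have bs: "set bs = B" "distinct bs" "sorted (map (theta k \<psi>) bs)"
    using xs by (auto simp: bs_def)
  have len: "length bs = card B"
    using bs distinct_card by fastforce
  have \<gamma>: "gamma k \<psi> B (Suc j) = theta k \<psi> (bs ! j)" if "j < card B" for j
    using beta_eq_sum_take[OF bs(3,2), of "Suc j"] beta_eq_sum_take[OF bs(3,2), of j] that len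
    by (simp add: gamma_def bs(1) take_Suc_conv_app_nth)
  have "(\<Sum>i=1..card B. h (gamma k \<psi> B i)) = (\<Sum>j<card B. h (gamma k \<psi> B (Suc j)))"
    by (simp add: sum.atLeast1_atMost_eq lessThan_atLeast0)
  also have "\<dots> = (\<Sum>j<length bs. h (theta k \<psi> (bs ! j)))"
    using len \<gamma> by (intro sum.cong) auto
  also have "\<dots> = (\<Sum>b\<in>B. h (theta k \<psi> b))"
    using sum.reindex_bij_betw[OF bij_betw_nth[OF bs(2) refl refl], of "\<lambda>b. h (theta k \<psi> b)"] bs(1)
    by simp
  finally show ?thesis .
qed

text \<open>Chernoff's bound: for \<open>z \<le> 1\<close> every counted function has weight at least \<open>z powi m\<close>
  in the expansion of the power on the right.\<close>

lemma card_sum_le_bound: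
  fixes \<theta> :: "'b \<Rightarrow> int" and z :: real
  assumes "finite I" "finite B" "0 < z" "z \<le> 1"
  shows "real (card {g \<in> I \<rightarrow>\<^sub>E B. (\<Sum>i\<in>I. \<theta> (g i)) \<le> m})
    \<le> z powi (- m) * (\<Sum>b\<in>B. z powi \<theta> b) ^ card I"
proof -
  let ?G = "{g \<in> I \<rightarrow>\<^sub>E B. (\<Sum>i\<in>I. \<theta> (g i)) \<le> m}"
  have fin: "finite (I \<rightarrow>\<^sub>E B)"
    using assms by (intro finite_PiE) auto
  have powi_sum: "z powi (\<Sum>i\<in>J. e i) = (\<Prod>i\<in>J. z powi e i)" for J :: "'a set" and e
    using assms(3) by (induction J rule: infinite_finite_induct) (auto simp: power_int_add)
  have "real (card ?G) = (\<Sum>g\<in>?G. 1)"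
    by simp
  also have "\<dots> \<le> (\<Sum>g\<in>?G. z powi (- m) * z powi (\<Sum>i\<in>I. \<theta> (g i)))"
  proof (intro sum_mono)
    fix g assume "g \<in> ?G"
    then have "1 \<le> z powi ((\<Sum>i\<in>I. \<theta> (g i)) - m)"
      using power_int_decreasing[of "(\<Sum>i\<in>I. \<theta> (g i)) - m" 0 z] assms(3,4) by simp
    also have "\<dots> = z powi (- m) * z powi (\<Sum>i\<in>I. \<theta> (g i))"
      using assms(3) by (simp flip: power_int_add)
    finally show "1 \<le> z powi (- m) * z powi (\<Sum>i\<in>I. \<theta> (g i))" .
  qed
  \<comment> \<open>Dropping the constraint on \<open>g\<close> only adds nonnegative terms, and the
    unconstrained sum factors over the coordinates.\<close>
  also have "\<dots> \<le> (\<Sum>g\<in>I \<rightarrow>\<^sub>E B. z powi (- m) * z powi (\<Sum>i\<in>I. \<theta> (g i)))"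
    using fin assms(3) by (intro sum_mono2) auto
  also have "\<dots> = z powi (- m) * (\<Sum>b\<in>B. z powi \<theta> b) ^ card I"
    using prod_sum_PiE[of I "\<lambda>_. B" "\<lambda>_ b. z powi \<theta> b"] assms(1,2)
    by (simp add: powi_sum sum_distrib_left)
  finally show ?thesis .
qed

text \<open>Convexity of \<open>x \<mapsto> \<Sum> exp (\<gamma> x)\<close>: a critical point beyond 0, where the derivative
  is already nonnegative, forces all \<open>\<gamma>\<close> to vanish.\<close>

lemma exists_powi_point_le_1:
  fixes \<gamma> :: "'b \<Rightarrow> int" and \<zeta> :: real
  assumes "finite B" "(\<Sum>b\<in>B. \<gamma> b) \<ge> 0" "\<zeta> > 0" "(\<Sum>b\<in>B. of_int (\<gamma> b) * \<zeta> powi \<gamma> b) = 0"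
  obtains z where "0 < z" "z \<le> 1" "(\<Sum>b\<in>B. z powi \<gamma> b) = (\<Sum>b\<in>B. \<zeta> powi \<gamma> b)"
proof (cases "\<zeta> \<le> 1")
  case False
  \<comment> \<open>For \<zeta> > 1 both factors have the sign of \<open>e\<close>. These positive
    terms cannot add up to minus the sum of the \<gamma>, which is at most 0.\<close>
  have strict: "of_int e * (\<zeta> powi e - 1) > 0" if "e \<noteq> 0" for e
  proof (cases "e > 0")
    case True
    then show ?thesis
      using one_less_power_int[of \<zeta> e] False by simp
  next
    case neg: False
    with that have "1 < \<zeta> powi (- e)"
      using one_less_power_int[of \<zeta> "- e"] False by simp
    then have "\<zeta> powi e < 1"
      using \<open>\<zeta> > 0\<close> by (simp add: power_int_minus one_less_inverse_iff)
    then show ?thesis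
      using neg that by (intro mult_neg_neg) auto
  qed
  then have nonneg: "of_int e * (\<zeta> powi e - 1) \<ge> 0" for e
    by (cases "e = 0") (auto simp: less_imp_le)
  have "(\<Sum>b\<in>B. of_int (\<gamma> b) * (\<zeta> powi \<gamma> b - 1)) = - of_int (\<Sum>b\<in>B. \<gamma> b)"
    using assms(4) by (simp add: right_diff_distrib sum_subtractf)
  also have "\<dots> \<le> 0"
    using assms(2) by (simp only: neg_le_0_iff_le of_int_0_le_iff)
  finally have "(\<Sum>b\<in>B. of_int (\<gamma> b) * (\<zeta> powi \<gamma> b - 1)) = 0"
    using nonneg by (intro antisym sum_nonneg) auto
  then have "\<forall>b\<in>B. \<gamma> b = 0"
    using sum_nonneg_eq_0_iff[OF assms(1), of "\<lambda>b. of_int (\<gamma> b) * (\<zeta> powi \<gamma> b - 1)"] nonneg strict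
    by (metis less_irrefl)
  \<comment> \<open>With all \<gamma> equal to 0 the power sum does not depend on its base, so
    \<open>z = 1\<close> serves.\<close>
  then show ?thesis
    using that[of 1] by simp
qed (use that assms(3) in blast)

section \<open>Multilinear expansion and evaluation of polynomials\<close>

lemma word_prod_Cons: "ys \<noteq> [] \<Longrightarrow> word_prod (x # ys) = x * word_prod ys"
  by (cases ys) simp_all

lemma word_prod_eq_0: "0 \<in> set xs \<Longrightarrow> word_prod xs = (0 :: 'a::ring)"
  by (induction xs rule: word_prod.induct) auto

lemma sum_PiE_insert:
  assumes "i \<notin> I"
  shows "(\<Sum>g\<in>insert i I \<rightarrow>\<^sub>E D. F g) = (\<Sum>b\<in>D. \<Sum>g\<in>I \<rightarrow>\<^sub>E D. F (g(i := b)))"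
proof -
  have "(\<Sum>g\<in>insert i I \<rightarrow>\<^sub>E D. F g) = (\<Sum>(b, g)\<in>D \<times> (I \<rightarrow>\<^sub>E D). F (g(i := b)))"
    unfolding PiE_insert_eq by (subst sum.reindex[OF inj_combinator[OF assms]])
      (simp add: case_prod_unfold)
  then show ?thesis
    by (simp add: sum.cartesian_product)
qed

context assoc_algebra
begin

text \<open>Distributivity: as no index repeats in \<open>w\<close>, choosing a summand for each
  letter amounts to a function \<open>g\<close> on the indices. The vectors \<open>h b t\<close> may
  depend on the degree \<open>t\<close>, the coefficients \<open>C i b\<close> may not.\<close>

lemma word_prod_expand:
  assumes "w \<noteq> []" "distinct (map fst w)"
    and "\<And>i t. (i, t) \<in> set w \<Longrightarrow> s (i, t) = (\<Sum>b\<in>D. sc (C i b) (h b t))"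
  shows "word_prod (map s w) = (\<Sum>g\<in>fst ` set w \<rightarrow>\<^sub>E D.
    sc (\<Prod>i\<in>fst ` set w. C i (g i)) (word_prod (map (\<lambda>(i, t). h (g i) t) w)))"
  using assms
proof (induction w rule: list_nonempty_induct)
  case (single x)
  obtain i t where x: "x = (i, t)" by fastforce
  then show ?case
    using single by (simp add: sum_PiE_insert)
next
  case (cons x w)
  obtain i t where x: "x = (i, t)" by fastforce
  let ?I = "fst ` set w"
  let ?W = "\<lambda>g. word_prod (map (\<lambda>(i, t). h (g i) t) w)"
  have i: "i \<notin> ?I"
    using cons.prems(1) x by auto
  have "word_prod (map s (x # w)) = s (i, t) * word_prod (map s w)"
    using cons.hyps by (simp add: word_prod_Cons x)
  also have "\<dots> = (\<Sum>b\<in>D. sc (C i b) (h b t)) *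
      (\<Sum>g\<in>?I \<rightarrow>\<^sub>E D. sc (\<Prod>j\<in>?I. C j (g j)) (?W g))"
    using cons.IH cons.prems x by simp
  also have "\<dots> = (\<Sum>b\<in>D. \<Sum>g\<in>?I \<rightarrow>\<^sub>E D. sc (C i b * (\<Prod>j\<in>?I. C j (g j))) (h b t * ?W g))"
    by (simp add: sum_product scale_mult_left scale_mult_right mult.commute)
  also have "\<dots> = (\<Sum>b\<in>D. \<Sum>g\<in>?I \<rightarrow>\<^sub>E D. sc (\<Prod>j\<in>insert i ?I. C j ((g(i := b)) j))
      (word_prod (map (\<lambda>(j, u). h ((g(i := b)) j) u) (x # w))))"
  proof (intro sum.cong refl)
    fix b g
    \<comment> \<open>Since \<open>i\<close> does not occur in the tail \<open>w\<close>, updating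
      \<open>g\<close> at \<open>i\<close> leaves the factors of the tail unchanged.\<close>
    have "(\<Prod>j\<in>?I. C j ((g(i := b)) j)) = (\<Prod>j\<in>?I. C j (g j))"
      using i by (intro prod.cong) auto
    moreover have "map (\<lambda>(j, u). h ((g(i := b)) j) u) w = map (\<lambda>(j, u). h (g j) u) w"
      using i by (intro map_cong) force+
    ultimately show "sc (C i b * (\<Prod>j\<in>?I. C j (g j))) (h b t * ?W g) =
      sc (\<Prod>j\<in>insert i ?I. C j ((g(i := b)) j))
        (word_prod (map (\<lambda>(j, u). h ((g(i := b)) j) u) (x # w)))"
      using i cons.hyps by (simp add: word_prod_Cons x del: map_eq_conv)
  qed
  also have "\<dots> = (\<Sum>g\<in>insert i ?I \<rightarrow>\<^sub>E D. sc (\<Prod>j\<in>insert i ?I. C j (g j))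
      (word_prod (map (\<lambda>(j, u). h (g j) u) (x # w))))"
    by (subst sum_PiE_insert[OF i]) (rule refl)
  finally show ?case
    by (simp add: x)
qed

text \<open>Addition and scaling can shrink supports through cancellation; summing over a common
  finite superset makes the evaluations comparable.\<close>

lemma eval_poly_eq_sum:
  assumes "finite K" "Poly_Mapping.keys f \<subseteq> K"
  shows "eval_poly sc s f = (\<Sum>w\<in>K. sc (Poly_Mapping.lookup f w) (word_prod (map s w)))"
  unfolding eval_poly_def using assms by (intro sum.mono_neutral_left) (auto simp: in_keys_iff)

lemma eval_poly_add: "eval_poly sc s (f + g) = eval_poly sc s f + eval_poly sc s g"
proof -
  let ?K = "Poly_Mapping.keys f \<union> Poly_Mapping.keys g"
  have "Poly_Mapping.keys (f + g) \<subseteq> ?K"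
    by (rule Poly_Mapping.keys_add)
  then show ?thesis
    by (simp add: eval_poly_eq_sum[of ?K] lookup_add scale_left_distrib sum.distrib)
qed

lemma eval_poly_scale: "eval_poly sc s (poly_scale c f) = sc c (eval_poly sc s f)"
proof -
  have "Poly_Mapping.keys (poly_scale c f) \<subseteq> Poly_Mapping.keys f"
    by (auto simp: in_keys_iff lookup_poly_scale)
  then show ?thesis
    by (simp add: eval_poly_eq_sum[of "Poly_Mapping.keys f"] lookup_poly_scale scale_sum_right)
qed

lemma eval_poly_0: "eval_poly sc s 0 = 0"
  by (simp add: eval_poly_def)

lemma eval_poly_single: "eval_poly sc s (Poly_Mapping.single w 1) = word_prod (map s w)"
  by (simp add: eval_poly_def)

end

text \<open>The words of the spanning monomials are those in which each index from 1 to
  \<open>n\<close> occurs exactly once. In this form later proofs need no permutations.\<close>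

lemma multilinear_polys_induct [consumes 1, case_names zero step]:
  fixes f :: "('t, 'f::field) gr_poly"
  assumes "f \<in> multilinear_polys n"
    and "P 0"
    and "\<And>c w f. distinct (map fst w) \<Longrightarrow> fst ` set w = {1..n} \<Longrightarrow> P f \<Longrightarrow>
      P (poly_scale c (Poly_Mapping.single w 1) + f)"
  shows "P f"
proof -
  interpret P: vector_space "poly_scale :: 'f \<Rightarrow> ('t, 'f) gr_poly \<Rightarrow> _"
    by (rule vector_space_poly_scale)
  show ?thesis
    using assms(1) unfolding multilinear_polys_def
  proof (induction rule: P.span_induct_alt)
    case (step c x y)
    then obtain \<sigma> and t :: "nat \<Rightarrow> 't" where x: "\<sigma> permutes {1..n}"
      "x = Poly_Mapping.single (map (\<lambda>i. (\<sigma> i, t i)) [1..<n + 1]) 1"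
      by blast
    have "map fst (map (\<lambda>i. (\<sigma> i, t i)) [1..<n + 1]) = map \<sigma> [1..<n + 1]"
      by simp
    moreover have "distinct (map \<sigma> [1..<n + 1])"
      using permutes_inj_on[OF x(1)] by (simp add: distinct_map del: upt_Suc)
    moreover have "fst ` set (map (\<lambda>i. (\<sigma> i, t i)) [1..<n + 1]) = \<sigma> ` {1..n}"
      by (simp add: image_image atLeastLessThanSuc_atLeastAtMost del: upt_Suc)
    ultimately show ?case
      unfolding x(2) using step(2) permutes_image[OF x(1)] by (intro assms(3)) (simp_all only:)
  qed (rule assms(2))
qed

section \<open>The homogeneous basis of the graded algebra\<close>

locale graded_matrix_algebra = assoc_algebra sc
  for sc :: "'f::field \<Rightarrow> 'a::ring \<Rightarrow> 'a" +
  fixes A :: "'t::semigroup_mult \<Rightarrow> 'a set" and k :: nat and \<psi> :: "'a set \<Rightarrow> 'f mat"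
    and \<B> :: "'t \<Rightarrow> 'a set"
  assumes finite_dim: "finite_dim sc"
    and graded: "graded_by sc A"
    and quotient_iso: "quotient_mat_iso sc jacobson_radical k \<psi>"
    and inter_radical: "A t \<inter> jacobson_radical = {0}"
    and basis: "is_basis_of sc (A t) (\<B> t)"
begin

definition D :: "'a set" where "D = (\<Union>t. \<B> t)"

lemma span_basis: "span (\<B> t) = A t" and independent_basis: "independent (\<B> t)"
  using basis[of t] by (auto simp: is_basis_of_def)

lemma basis_subset: "\<B> t \<subseteq> A t"
  using span_superset[of "\<B> t"] by (simp add: span_basis)

lemma graded_mult: "x \<in> A t \<Longrightarrow> y \<in> A u \<Longrightarrow> x * y \<in> A (t * u)"
  using graded by (simp add: graded_by_def)

lemma subspace_A: "subspace (A t)"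
  using graded by (simp add: graded_by_def)

lemma graded_decomp:
  obtains f where "\<And>t. f t \<in> A t" "finite {t. f t \<noteq> 0}" "a = (\<Sum>t | f t \<noteq> 0. f t)"
  using graded unfolding graded_by_def by metis

text \<open>Both \<open>f\<close> and the zero family decompose 0, so the uniqueness clause of
  \<open>graded_by\<close> identifies them.\<close>

lemma graded_direct:
  assumes "\<And>t. f t \<in> A t" "finite T" "\<And>t. t \<notin> T \<Longrightarrow> f t = 0" "(\<Sum>t\<in>T. f t) = 0"
  shows "f t = 0"
proof -
  define P where "P g \<longleftrightarrow> (\<forall>t. g t \<in> A t) \<and> finite {t. g t \<noteq> 0} \<and> 0 = (\<Sum>t | g t \<noteq> 0. g t)"
    for g
  have "\<exists>!g. P g"
    using graded unfolding graded_by_def P_def by blast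
  moreover have "finite {t. f t \<noteq> 0}"
    using assms(2,3) by (metis (mono_tags, lifting) finite_subset mem_Collect_eq subsetI)
  moreover have "(\<Sum>t | f t \<noteq> 0. f t) = (\<Sum>t\<in>T. f t)"
    using assms(2,3) by (intro sum.mono_neutral_left) auto
  then have "P f"
    unfolding P_def using assms calculation(2) by simp
  moreover have "P (\<lambda>t. 0)"
    using subspace_0[OF subspace_A] by (simp add: P_def)
  ultimately have "f = (\<lambda>t. 0)"
    by blast
  then show ?thesis by simp
qed

text \<open>Otherwise \<open>b\<close> in degree \<open>t\<close> and \<open>- b\<close> in degree
  \<open>u\<close> would be a nontrivial decomposition of 0.\<close>

lemma degree_unique:
  assumes "b \<in> \<B> t" "b \<in> \<B> u"
  shows "t = u"
proof (rule ccontr)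
  assume neq: "t \<noteq> u"
  define f where "f v = (if v = t then b else if v = u then - b else 0)" for v
  have b: "b \<in> A t" "b \<in> A u"
    using assms basis_subset by auto
  have "f t = 0"
  proof (rule graded_direct[of f "{t, u}"])
    show "f v \<in> A v" for v
      using b subspace_0[OF subspace_A] subspace_neg[OF subspace_A b(2)] by (auto simp: f_def)
    show "(\<Sum>v\<in>{t, u}. f v) = 0"
      using neq by (simp add: f_def)
  qed (auto simp: f_def)
  then have "b = 0" by (simp add: f_def)
  then show False
    using assms(1) independent_basis[of t] dependent_zero by blast
qed

definition deg :: "'a \<Rightarrow> 't" where "deg b = (SOME t. b \<in> \<B> t)"

lemma deg_eq: "b \<in> \<B> t \<Longrightarrow> deg b = t"
  unfolding deg_def using degree_unique by (metis someI)

text \<open>Grouping a relation by degree gives homogeneous components with sum 0. Each vanishes by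
  directness, and independence within one degree finishes the argument.\<close>

lemma independent_D: "independent D"
  unfolding independent_explicit_module
proof (intro allI impI)
  fix S u v assume S: "finite S" "S \<subseteq> D" "(\<Sum>v\<in>S. sc (u v) v) = 0" "v \<in> S"
  define f where "f t = (\<Sum>b | b \<in> S \<and> deg b = t. sc (u b) b)" for t
  have deg: "b \<in> \<B> (deg b)" if "b \<in> S" for b
    using that S(2) deg_eq by (auto simp: D_def)
  have "f t = 0" for t
  proof (rule graded_direct[of f "deg ` S"])
    show "f t \<in> A t" for t
      unfolding f_def using deg subsetD[OF basis_subset]
      by (intro subspace_sum[OF subspace_A] subspace_scale[OF subspace_A]) blast
    show "f t = 0" if "t \<notin> deg ` S" for t
      unfolding f_def using that by (intro sum.neutral) auto
    show "(\<Sum>t\<in>deg ` S. f t) = 0"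
      unfolding f_def using S(1,3) sum.group[of S "deg ` S" deg "\<lambda>b. sc (u b) b"] by simp
  qed (use S in auto)
  then have "(\<Sum>b | b \<in> S \<and> deg b = deg v. sc (u b) b) = 0"
    by (simp add: f_def)
  moreover have "finite {b. b \<in> S \<and> deg b = deg v}" "{b. b \<in> S \<and> deg b = deg v} \<subseteq> \<B> (deg v)"
    using S(1) deg by force+
  moreover have "v \<in> {b. b \<in> S \<and> deg b = deg v}"
    using S(4) by simp
  ultimately show "u v = 0"
    using independent_basis[of "deg v"] unfolding independent_explicit_module by blast
qed

lemma span_D: "span D = UNIV"
proof -
  have "a \<in> span D" for a
  proof -
    obtain f where f: "\<And>t. f t \<in> A t" "a = (\<Sum>t | f t \<noteq> 0. f t)"
      using graded_decomp by metis
    have "A t \<subseteq> span D" for t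
      unfolding span_basis[symmetric] by (rule span_mono) (auto simp: D_def)
    then show ?thesis
      unfolding f(2) using f(1) by (intro span_sum) auto
  qed
  then show ?thesis by blast
qed

lemma finite_D: "finite D"
proof -
  obtain B where B: "finite B" "span B = UNIV"
    using finite_dim by (auto simp: finite_dim_def)
  then show ?thesis
    using independent_span_bound[OF B(1) independent_D] by simp
qed

lemma dim_eq_card_D: "dim UNIV = card D"
  by (rule dim_eq_card) (simp_all add: span_D independent_D)

section \<open>Images in the matrix algebra and superadditivity of \<open>theta\<close>\<close>

text \<open>The projection to the quotient followed by \<open>\<psi>\<close>, so that later
  arguments avoid cosets.\<close>

definition M :: "'a \<Rightarrow> 'f mat" where "M a = \<psi> (a +o jacobson_radical)"

lemma M_carrier: "M a \<in> carrier_mat k k"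
  and M_add: "M (a + b) = M a + M b"
  and M_mult: "M (a * b) = M a * M b"
  using quotient_iso unfolding quotient_mat_iso_def bij_betw_def M_def by auto

lemma M_0: "M 0 = 0\<^sub>m k k"
proof (rule eq_matI)
  fix i j assume ij: "i < dim_row (0\<^sub>m k k :: 'f mat)" "j < dim_col (0\<^sub>m k k :: 'f mat)"
  then have "M 0 $$ (i, j) = M 0 $$ (i, j) + M 0 $$ (i, j)"
    using M_add[of 0 0] M_carrier[of 0] by (metis add.right_neutral carrier_matD index_add_mat(1) index_zero_mat(2,3))
  then have "M 0 $$ (i, j) = 0"
    by (metis add_cancel_right_right)
  then show "M 0 $$ (i, j) = 0\<^sub>m k k $$ (i, j)"
    using ij by simp
qed (use M_carrier[of 0] in auto)

text \<open>Injectivity of \<open>\<psi>\<close> on cosets gives \<open>a\<close> the same coset as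
  0, and this coset contains \<open>a\<close> because the radical contains 0.\<close>

lemma in_radical_if_M_eq_0:
  assumes "M a = 0\<^sub>m k k"
  shows "a \<in> jacobson_radical"
proof -
  have "\<psi> (a +o jacobson_radical) = \<psi> (0 +o jacobson_radical)"
    using assms M_0 by (simp add: M_def)
  then have "a +o jacobson_radical = 0 +o jacobson_radical"
    using quotient_iso unfolding quotient_mat_iso_def bij_betw_def by (meson inj_onD rangeI)
  moreover have "0 \<in> (jacobson_radical :: 'a set)"
    by (auto simp: jacobson_radical_def maximal_modular_left_ideal_def modular_left_ideal_def
        left_ideal_def)
  then have "a + 0 \<in> a +o jacobson_radical"
    by (rule set_plus_intro2)
  ultimately show ?thesis
    by simp
qed

lemma theta_le:
  assumes "i < k" "j < k" "M a $$ (i, j) \<noteq> 0"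
  shows "theta k \<psi> a \<le> int i - int j"
  unfolding theta_def
proof (rule Min_le)
  have "finite ((\<lambda>(i, j). int i - int j) ` ({..<k} \<times> {..<k}))"
    by simp
  then show "finite {int i - int j | i j. i < k \<and> j < k \<and> \<psi> (a +o jacobson_radical) $$ (i, j) \<noteq> 0}"
    by (rule finite_subset[rotated]) auto
qed (use assms in \<open>auto simp: M_def\<close>)

text \<open>A nonzero entry of a product comes from a chain of nonzero entries of the factors, and
  the differences of row and column indices telescope along the chain.\<close>

lemma sum_theta_le:
  assumes "xs \<noteq> []" "i < k" "j < k" "M (word_prod xs) $$ (i, j) \<noteq> 0"
  shows "(\<Sum>x\<leftarrow>xs. theta k \<psi> x) \<le> int i - int j"
  using assms
proof (induction xs arbitrary: i j rule: list_nonempty_induct)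
  case (single x)
  then show ?case by (simp add: theta_le)
next
  case (cons x xs)
  let ?P = "M x" and ?Q = "M (word_prod xs)"
  have "(?P * ?Q) $$ (i, j) = (\<Sum>l<k. ?P $$ (i, l) * ?Q $$ (l, j))"
    using cons.prems(1,2) M_carrier[of x] M_carrier[of "word_prod xs"]
    by (simp add: scalar_prod_def lessThan_atLeast0)
  then have "(\<Sum>l<k. ?P $$ (i, l) * ?Q $$ (l, j)) \<noteq> 0"
    using cons.prems(3) cons.hyps by (simp add: word_prod_Cons M_mult)
  \<comment> \<open>A nonzero sum has a nonzero term, which supplies the intermediate index of the
    chain.\<close>
  then obtain l where l: "l < k" "?P $$ (i, l) * ?Q $$ (l, j) \<noteq> 0"
    by (metis (no_types, lifting) lessThan_iff sum.neutral)
  then have "theta k \<psi> x \<le> int i - int l" "(\<Sum>x\<leftarrow>xs. theta k \<psi> x) \<le> int l - int j"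
    using theta_le[of i l x] cons.IH[of l j] cons.prems by auto
  then show ?case by simp
qed

lemma word_prod_homogeneous:
  assumes "xs \<noteq> []" "\<forall>x\<in>set xs. \<exists>t. x \<in> A t"
  shows "\<exists>t. word_prod xs \<in> A t"
  using assms
proof (induction xs rule: list_nonempty_induct)
  case (cons x xs)
  then obtain t u where "x \<in> A t" "word_prod xs \<in> A u" by auto
  then show ?case
    using graded_mult[of x t "word_prod xs" u] cons.hyps by (auto simp: word_prod_Cons)
qed simp

text \<open>A homogeneous product vanishes as soon as its image in \<open>M_k(F)\<close> does, and a nonzero
  matrix has a nonzero entry with \<open>i - j \<le> k - 1\<close>.\<close>

lemma word_prod_nonzero_sum_theta:
  assumes "xs \<noteq> []" "\<forall>x\<in>set xs. \<exists>t. x \<in> A t" "word_prod xs \<noteq> 0"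
  shows "(\<Sum>x\<leftarrow>xs. theta k \<psi> x) \<le> int k - 1"
proof -
  obtain t where "word_prod xs \<in> A t"
    using word_prod_homogeneous[OF assms(1,2)] ..
  then have "M (word_prod xs) \<noteq> 0\<^sub>m k k"
    using in_radical_if_M_eq_0 inter_radical[of t] assms(3) by blast
  then obtain i j where "i < k" "j < k" "M (word_prod xs) $$ (i, j) \<noteq> 0"
    using M_carrier[of "word_prod xs"] by (metis carrier_matD eq_matI index_zero_mat)
  then show ?thesis
    using sum_theta_le[OF assms(1), of i j] by linarith
qed

section \<open>Substitution of basis elements and the codimension bound\<close>

text \<open>Sending variables of the wrong degree to 0 makes this a graded substitution for every
  \<open>g\<close>.\<close>

definition basis_subst :: "(nat \<Rightarrow> 'a) \<Rightarrow> nat \<times> 't \<Rightarrow> 'a" where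
  "basis_subst g = (\<lambda>(i, t). if g i \<in> \<B> t then g i else 0)"

text \<open>Every monomial uses each \<open>g i\<close> once, so all orderings share the same sum of
  \<open>theta\<close> values; when it is too large, every monomial vanishes.\<close>

lemma eval_basis_subst_eq_0:
  assumes "f \<in> multilinear_polys n" "n \<ge> 1" "(\<Sum>i=1..n. theta k \<psi> (g i)) > int k - 1"
  shows "eval_poly sc (basis_subst g) f = 0"
  using assms(1)
proof (induction rule: multilinear_polys_induct)
  case (step c w f)
  let ?xs = "map (basis_subst g) w"
  have "w \<noteq> []"
    using step(2) assms(2) by auto
  have "word_prod ?xs = 0"
  proof (rule ccontr)
    assume nz: "word_prod ?xs \<noteq> 0"
    \<comment> \<open>A nonzero product has no zero letter, so all degrees match and each letter is
      the corresponding \<open>g i\<close>.\<close>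
    then have "0 \<notin> set ?xs"
      using word_prod_eq_0 by blast
    then have nz_letter: "basis_subst g x \<noteq> 0" if "x \<in> set w" for x
      using that by (metis image_eqI set_map)
    have letters: "basis_subst g x = g (fst x)" "g (fst x) \<in> \<B> (snd x)" if "x \<in> set w" for x
      using nz_letter[OF that] by (auto simp: basis_subst_def split: if_splits prod.splits)
    then have "(\<Sum>x\<leftarrow>?xs. theta k \<psi> x) \<le> int k - 1"
      using nz \<open>w \<noteq> []\<close> basis_subset by (intro word_prod_nonzero_sum_theta) fastforce+
    moreover have "(\<Sum>x\<leftarrow>?xs. theta k \<psi> x) = (\<Sum>i\<leftarrow>map fst w. theta k \<psi> (g i))"
      using letters by (auto intro!: arg_cong[of _ _ sum_list])
    moreover have "\<dots> = (\<Sum>i=1..n. theta k \<psi> (g i))"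
      using step(1,2) by (subst sum_list_distinct_conv_sum_set) auto
    ultimately show False
      using assms(3) by simp
  qed
  then show ?case
    using step(3) by (simp add: eval_poly_add eval_poly_scale eval_poly_single)
qed (simp add: eval_poly_0)

text \<open>By multilinearity, the value at any graded substitution is a linear combination of the
  values at the substitutions \<open>basis_subst g\<close>.\<close>

lemma graded_identity_if_basis_subst:
  assumes f: "f \<in> multilinear_polys n" and "n \<ge> 1"
    and zero: "\<And>g. g \<in> {1..n} \<rightarrow>\<^sub>E D \<Longrightarrow> eval_poly sc (basis_subst g) f = 0"
  shows "f \<in> graded_identities sc A"
proof -
  have "[] \<notin> Poly_Mapping.keys f"
    using f
  proof (induction rule: multilinear_polys_induct)
    case (step c w f)
    then have "w \<noteq> []"
      using \<open>n \<ge> 1\<close> by auto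
    then show ?case
      using step(3) by (simp add: in_keys_iff lookup_add lookup_poly_scale lookup_single)
  qed simp
  moreover have "eval_poly sc s f = 0" if s: "\<forall>i t. s (i, t) \<in> A t" for s
  proof -
    \<comment> \<open>Each \<open>b\<close> determines its degree, so the coefficient depends on
      \<open>i\<close> and \<open>b\<close> only. Hence all words share the coefficients in the
      expansion, whatever the degrees of their letters.\<close>
    define C where "C i b = representation (\<B> (deg b)) (s (i, deg b)) b" for i b
    have s_eq: "s (i, t) = (\<Sum>b\<in>D. sc (C i b) (if b \<in> \<B> t then b else 0))" for i t
    proof -
      have "finite (\<B> t)"
        by (rule finite_subset[OF _ finite_D]) (auto simp: D_def)
      then have "s (i, t) = (\<Sum>b\<in>\<B> t. sc (representation (\<B> t) (s (i, t)) b) b)"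
        using s by (subst sum_representation_eq[OF independent_basis]) (auto simp: span_basis)
      also have "\<dots> = (\<Sum>b\<in>\<B> t. sc (C i b) (if b \<in> \<B> t then b else 0))"
        by (intro sum.cong) (auto simp: C_def deg_eq)
      also have "\<dots> = (\<Sum>b\<in>D. sc (C i b) (if b \<in> \<B> t then b else 0))"
        using finite_D by (intro sum.mono_neutral_left) (auto simp: D_def)
      finally show ?thesis .
    qed
    have "eval_poly sc s f =
        (\<Sum>g\<in>{1..n} \<rightarrow>\<^sub>E D. sc (\<Prod>i=1..n. C i (g i)) (eval_poly sc (basis_subst g) f))"
      using f
    proof (induction rule: multilinear_polys_induct)
      case (step c w f)
      have "w \<noteq> []"
        using step(2) \<open>n \<ge> 1\<close> by auto
      then have "word_prod (map s w) = (\<Sum>g\<in>{1..n} \<rightarrow>\<^sub>E D.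
          sc (\<Prod>i=1..n. C i (g i)) (word_prod (map (basis_subst g) w)))"
        using word_prod_expand[of w s C "\<lambda>b t. if b \<in> \<B> t then b else 0" D] step(1,2) s_eq
        by (simp add: basis_subst_def)
      then show ?case
        using step(3) by (simp add: eval_poly_add eval_poly_scale eval_poly_single
            scale_right_distrib scale_sum_right sum.distrib mult.commute)
    qed (simp add: eval_poly_0)
    then show ?thesis
      using zero by simp
  qed
  ultimately show ?thesis
    by (simp add: graded_identities_def free_gr_algebra_def)
qed

text \<open>The functionals are the coordinates along \<open>D\<close> of the values at
  \<open>basis_subst g\<close>, for the tuples \<open>g\<close> that satisfy the inequality.\<close>

lemma graded_codim_le:
  assumes "n \<ge> 1"
  shows "graded_codim sc A n \<le>
    card {g \<in> {1..n} \<rightarrow>\<^sub>E D. (\<Sum>i=1..n. theta k \<psi> (g i)) \<le> int k - 1} * card D"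
proof -
  interpret P: vector_space "poly_scale :: 'f \<Rightarrow> ('t, 'f) gr_poly \<Rightarrow> _"
    by (rule vector_space_poly_scale)
  let ?V = "multilinear_polys n :: ('t, 'f) gr_poly set"
  let ?W = "?V \<inter> graded_identities sc A"
  let ?G = "{g \<in> {1..n} \<rightarrow>\<^sub>E D. (\<Sum>i=1..n. theta k \<psi> (g i)) \<le> int k - 1}"
  have V: "P.subspace ?V"
    unfolding multilinear_polys_def by (rule P.subspace_span)
  have "P.subspace (graded_identities sc A)"
    unfolding P.subspace_def graded_identities_def free_gr_algebra_def
    by (auto simp: eval_poly_0 eval_poly_add eval_poly_scale in_keys_iff lookup_add lookup_poly_scale)
  with V have "\<exists>B. quotient_basis poly_scale ?V ?W B"
    by (intro P.quotient_basis_exists P.subspace_inter) auto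
  then have B: "quotient_basis poly_scale ?V ?W (SOME B. quotient_basis poly_scale ?V ?W B)"
    by (rule someI_ex)
  define L where
    "L f = (\<lambda>(g, b). if g \<in> ?G then representation D (eval_poly sc (basis_subst g) f) b else 0)"
    for f
  have "card (SOME B. quotient_basis poly_scale ?V ?W B) \<le> card (?G \<times> D)"
  proof (rule P.card_quotient_basis_le[OF V B, where L = L])
    show "L (f + f') x = L f x + L f' x" for f f' x
      by (auto simp: L_def eval_poly_add representation_add independent_D span_D split: prod.splits)
    show "L (poly_scale c f) x = c * L f x" for c f x
      by (auto simp: L_def eval_poly_scale representation_scale independent_D span_D split: prod.splits)
    have "finite ({1..n} \<rightarrow>\<^sub>E D)"
      using finite_D by (intro finite_PiE) auto
    then show "finite (?G \<times> D)"
      using finite_D by simp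
    show "L f x = 0" if "x \<notin> ?G \<times> D" for f x
      using that representation_ne_zero by (auto simp: L_def split: prod.splits)
    show "f \<in> ?W" if "f \<in> ?V" and L: "\<And>x. L f x = 0" for f
    proof -
      have "eval_poly sc (basis_subst g) f = 0" if g: "g \<in> {1..n} \<rightarrow>\<^sub>E D" for g
      proof (cases "g \<in> ?G")
        case True
        then have "representation D (eval_poly sc (basis_subst g) f) b = 0" for b
          using L[of "(g, b)"] by (simp add: L_def)
        then show ?thesis
          using sum_representation_eq[OF independent_D, of "eval_poly sc (basis_subst g) f" D]
          by (simp add: span_D finite_D)
      \<comment> \<open>Tuples outside \<open>?G\<close> give the value 0 for every multilinear
        polynomial, so \<open>L\<close> loses nothing by ignoring them.\<close>
      next
        case False
        then show ?thesis
          using eval_basis_subst_eq_0[OF \<open>f \<in> ?V\<close> assms] g by simp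
      qed
      then show ?thesis
        using graded_identity_if_basis_subst[OF \<open>f \<in> ?V\<close> assms] \<open>f \<in> ?V\<close> by blast
    qed
  qed
  then show ?thesis
    by (simp add: graded_codim_def quotient_dim_def card_cartesian_product)
qed

text \<open>Combines the count of functionals with Chernoff's bound. The \<open>+ 1\<close> makes
  the constant visibly positive, as \<open>limsup_root_le\<close> demands.\<close>

lemma graded_codim_bound:
  assumes "n \<ge> 1" "0 < z" "z \<le> (1 :: real)"
  shows "real (graded_codim sc A n) \<le> (z powi (1 - int k) * (card D + 1)) * (\<Sum>b\<in>D. z powi theta k \<psi> b) ^ n"
proof -
  let ?G = "{g \<in> {1..n} \<rightarrow>\<^sub>E D. (\<Sum>i=1..n. theta k \<psi> (g i)) \<le> int k - 1}"
  have "real (graded_codim sc A n) \<le> real (card ?G) * card D"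
    unfolding of_nat_mult[symmetric] of_nat_le_iff by (rule graded_codim_le[OF assms(1)])
  also have "\<dots> \<le> (z powi (1 - int k) * (\<Sum>b\<in>D. z powi theta k \<psi> b) ^ n) * (card D + 1)"
    using card_sum_le_bound[of "{1..n}" D z "theta k \<psi>" "int k - 1"] assms finite_D
    by (intro mult_mono) auto
  finally show ?thesis
    by (simp add: mult_ac)
qed

end

section \<open>Passage to the limit\<close>

text \<open>The \<open>n\<close>-th root of the positive constant \<open>K\<close> tends to 1, so
  only \<open>X\<close> survives.\<close>

lemma limsup_root_le:
  fixes c :: "nat \<Rightarrow> real"
  assumes "K > 0" "X \<ge> 0" "\<And>n. n \<ge> 1 \<Longrightarrow> 0 \<le> c n \<and> c n \<le> K * X ^ n"
  shows "limsup (\<lambda>n. ereal (root n (c n))) \<le> ereal X"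
proof -
  have "limsup (\<lambda>n. ereal (root n (c n))) \<le> limsup (\<lambda>n. ereal (root n K * X))"
  proof (rule Limsup_mono, rule eventually_sequentiallyI)
    fix n :: nat assume n: "1 \<le> n"
    then have "root n (c n) \<le> root n (K * X ^ n)"
      using assms(3) by simp
    also have "\<dots> = root n K * X"
      using n assms(2) by (simp add: real_root_mult real_root_power_cancel)
    finally show "ereal (root n (c n)) \<le> ereal (root n K * X)"
      by simp
  qed
  also have "(\<lambda>n. root n K * X) \<longlonglongrightarrow> 1 * X"
    by (intro tendsto_intros LIMSEQ_root_const assms(1))
  then have "limsup (\<lambda>n. ereal (root n K * X)) = ereal X"
    by (intro lim_imp_Limsup) simp_all
  finally show ?thesis .
qed

theorem theorem9p8:
  fixes sc :: "'f::field_char_0 \<Rightarrow> 'a::ring \<Rightarrow> 'a"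
    and A :: "'t::semigroup_mult \<Rightarrow> 'a set"
    and k r :: nat
    and \<psi> :: "'a set \<Rightarrow> 'f mat"
    and \<B> :: "'t \<Rightarrow> 'a set"
    and \<gamma> :: "nat \<Rightarrow> int"
    and \<zeta> :: real
  assumes "assoc_algebra sc" and "finite_dim sc"
    and "graded_by sc A"
    and "k \<ge> 1" and "quotient_mat_iso sc jacobson_radical k \<psi>"
    and "\<forall>t. A t \<inter> jacobson_radical = {0}"
    and "r = vector_space.dim sc (UNIV :: 'a set)"
    and "\<forall>t. is_basis_of sc (A t) (\<B> t)"
    and "\<gamma> = gamma k \<psi> (\<Union>t. \<B> t)"
    and "(\<Sum>i=1..r. \<gamma> i) \<ge> 0"
    and "\<zeta> > 0" and "(\<Sum>i=1..r. of_int (\<gamma> i) * \<zeta> powi (\<gamma> i - \<gamma> 1)) = 0"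
  shows "limsup (\<lambda>n. ereal (root n (real (graded_codim sc A n))))
           \<le> ereal (\<Sum>i=1..r. \<zeta> powi (\<gamma> i))"
proof -
  interpret assoc_algebra sc by fact
  interpret graded_matrix_algebra sc A k \<psi> \<B>
    using assms by unfold_locales auto
  have r: "r = card D"
    using assms(7) by (simp add: dim_eq_card_D)
  have \<gamma>: "\<gamma> = gamma k \<psi> D"
    using assms(9) by (simp add: D_def)
  \<comment> \<open>Multiplying by a power of \<zeta> removes the shift by \<open>\<gamma> 1\<close>
    from the exponents.\<close>
  have "(\<Sum>i=1..r. of_int (\<gamma> i) * \<zeta> powi \<gamma> i) =
      \<zeta> powi \<gamma> 1 * (\<Sum>i=1..r. of_int (\<gamma> i) * \<zeta> powi (\<gamma> i - \<gamma> 1))"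
    using \<open>\<zeta> > 0\<close> by (simp add: sum_distrib_left power_int_diff field_simps)
  then have critical: "(\<Sum>i=1..r. of_int (\<gamma> i) * \<zeta> powi \<gamma> i) = 0"
    using assms(12) by simp
  \<comment> \<open>The counting bound needs a base at most 1, which \<zeta> itself may exceed;
    \<open>z\<close> has the same power sum.\<close>
  obtain z where z: "0 < z" "z \<le> 1" "(\<Sum>i=1..r. z powi \<gamma> i) = (\<Sum>i=1..r. \<zeta> powi \<gamma> i)"
    using exists_powi_point_le_1[of "{1..r}" \<gamma> \<zeta>] assms(10,11) critical by blast
  have "(\<Sum>b\<in>D. z powi theta k \<psi> b) = (\<Sum>i=1..r. z powi \<gamma> i)"
    unfolding \<gamma> r by (rule sum_gamma[OF finite_D, symmetric])
  then have sum_eq: "(\<Sum>b\<in>D. z powi theta k \<psi> b) = (\<Sum>i=1..r. \<zeta> powi \<gamma> i)"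
    using z(3) by simp
  show ?thesis
  proof (rule limsup_root_le)
    show "z powi (1 - int k) * (card D + 1) > 0"
      using z(1) by simp
    show "(\<Sum>i=1..r. \<zeta> powi \<gamma> i) \<ge> 0"
      using \<open>\<zeta> > 0\<close> by (intro sum_nonneg) simp
    show "0 \<le> real (graded_codim sc A n) \<and> real (graded_codim sc A n) \<le>
        z powi (1 - int k) * (card D + 1) * (\<Sum>i=1..r. \<zeta> powi \<gamma> i) ^ n" if "n \<ge> 1" for n
      using graded_codim_bound[OF that z(1,2)] sum_eq by simp
  qed
qed

end
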